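(* Let $V$ be a finite-dimensional vector space over a field $\mathbb{F}$ of characteristic different from $2$, let $n:=\dim V$, and let $b$ be a non-degenerate bilinear form on $V$ which is either symmetric or alternating. Let $\nu$ be the Witt index of $b$. (a) The greatest possible dimension of a linear subspace of $\mathcal{S}_b$ consisting only of nilpotent endomorphisms is $\nu(n-\nu)$. (b) The greatest possible dimension of a linear subspace of $\mathcal{A}_b$ consisting only of nilpotent endomorphisms is $\nu(n-\nu-1)$.
   Context: A bilinear form $b$ on $V$ is non-degenerate if $\{y\in V:\forall x\in V,\ b(x,y)=0\}=\{0\}$. A linear subspace $X$ of $V$ is totally singular for $b$ if $b(x,y)=0$ for all $x,y\in X$; the Witt index of $b$ is the maximal dimension of a totally singular subspace. An endomorphism $u$ of $V$ is $b$-symmetric (resp. $b$-alternating) if the bilinear form $(x,y)\mapsto b(x,u(y))$ is symmetric (resp. alternating, i.e. vanishes on all pairs $(x,x)$). $\mathcal{S}_b$ (resp. $\mathcal{A}_b$) denotes the linear subspace of $\mathrm{End}(V)$ of all $b$-symmetric (resp. $b$-alternating) endomorphisms. This terminology is used regardless of whether $b$ is symmetric or alternating. *)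

theory Defs
  imports Main HOL.Vector_Spaces "HOL-Library.Function_Algebras"
begin

text \<open>V is an abstract finite-dimensional vector space over the field 'f, given by
  a scalar multiplication scale on a type 'v (Vector_Spaces library).
  End(V) is the space of linear maps 'v => 'v, with the pointwise vector space structure.\<close>

definition bilinear_form :: "('f::field \<Rightarrow> 'v::ab_group_add \<Rightarrow> 'v) \<Rightarrow> ('v \<Rightarrow> 'v \<Rightarrow> 'f) \<Rightarrow> bool" where
  "bilinear_form scale b \<longleftrightarrow>
     (\<forall>x. Vector_Spaces.linear scale (*) (b x)) \<and> (\<forall>y. Vector_Spaces.linear scale (*) (\<lambda>x. b x y))"

definition symmetric_form :: "('v \<Rightarrow> 'v \<Rightarrow> 'f) \<Rightarrow> bool" where
  "symmetric_form b \<longleftrightarrow> (\<forall>x y. b x y = b y x)"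

definition alternating_form :: "('v \<Rightarrow> 'v \<Rightarrow> 'f::zero) \<Rightarrow> bool" where
  "alternating_form b \<longleftrightarrow> (\<forall>x. b x x = 0)"

definition nondegenerate :: "('v::zero \<Rightarrow> 'v \<Rightarrow> 'f::zero) \<Rightarrow> bool" where
  "nondegenerate b \<longleftrightarrow> {y. \<forall>x. b x y = 0} = {0}"

definition totally_singular :: "('f::field \<Rightarrow> 'v::ab_group_add \<Rightarrow> 'v) \<Rightarrow> ('v \<Rightarrow> 'v \<Rightarrow> 'f) \<Rightarrow> 'v set \<Rightarrow> bool" where
  "totally_singular scale b X \<longleftrightarrow> module.subspace scale X \<and> (\<forall>x\<in>X. \<forall>y\<in>X. b x y = 0)"

definition witt_index :: "('f::field \<Rightarrow> 'v::ab_group_add \<Rightarrow> 'v) \<Rightarrow> ('v \<Rightarrow> 'v \<Rightarrow> 'f) \<Rightarrow> nat" where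
  "witt_index scale b = Max {vector_space.dim scale X | X. totally_singular scale b X}"

definition end_scale :: "('f::field \<Rightarrow> 'v::ab_group_add \<Rightarrow> 'v) \<Rightarrow> 'f \<Rightarrow> ('v \<Rightarrow> 'v) \<Rightarrow> ('v \<Rightarrow> 'v)" where
  "end_scale scale c u = (\<lambda>x. scale c (u x))"

definition b_symmetric_endos :: "('f::field \<Rightarrow> 'v::ab_group_add \<Rightarrow> 'v) \<Rightarrow> ('v \<Rightarrow> 'v \<Rightarrow> 'f) \<Rightarrow> ('v \<Rightarrow> 'v) set" where
  "b_symmetric_endos scale b =
     {u. Vector_Spaces.linear scale scale u \<and> (\<forall>x y. b x (u y) = b y (u x))}"

definition b_alternating_endos :: "('f::field \<Rightarrow> 'v::ab_group_add \<Rightarrow> 'v) \<Rightarrow> ('v \<Rightarrow> 'v \<Rightarrow> 'f) \<Rightarrow> ('v \<Rightarrow> 'v) set" where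
  "b_alternating_endos scale b =
     {u. Vector_Spaces.linear scale scale u \<and> (\<forall>x. b x (u x) = 0)}"

definition nilpotent_endo :: "('v::zero \<Rightarrow> 'v) \<Rightarrow> bool" where
  "nilpotent_endo u \<longleftrightarrow> (\<exists>k. u ^^ k = (\<lambda>x. 0))"

end

theory Submission
  imports Defs
begin

text \<open>
  Fix a maximal totally singular subspace \<open>F\<close> with a full flag. Together with the orthogonals of
  its members it gives a filtration of \<open>V\<close>, and a basis of \<open>V\<close> adapted to it is graded by weights
  in \<open>{-\<nu>..\<nu>}\<close>: the weight 0 part is anisotropic and every other weight occurs exactly once.
  The endomorphisms of the given symmetry type that strictly lower the filtration form a space \<open>N\<close>
  of nilpotent maps of the announced dimension.

  Conversely, let \<open>W\<close> be a space of nilpotent maps of that symmetry type. Since the trace of a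
  nilpotent map is zero and \<open>2\<close> is invertible, expanding \<open>tr ((u + v)\<^sup>2)\<close> gives
  \<open>tr (u v) = 0\<close> for \<open>u, v \<in> W\<close>. An element of \<open>W\<close> that is trace-orthogonal to \<open>N\<close> preserves the
  filtration; being nilpotent it acts by zero on the one-dimensional graded pieces, and also on the
  anisotropic piece, where \<open>b(u\<^sup>m x, u\<^sup>m x) = \<plusminus>b(x, u\<^sup>2\<^sup>m x)\<close>. Hence it lies in \<open>N\<close>. So the trace
  pairing embeds \<open>W / (W \<inter> N)\<close> into the dual of \<open>N / (W \<inter> N)\<close>, and \<open>dim W \<le> dim N\<close>.
\<close>

subsection \<open>The trace\<close>

context vector_space
begin

text \<open>The basis is a parameter and may span a proper invariant subspace, so that traces of
  restrictions are covered as well.\<close>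

definition trace_on :: "'b set \<Rightarrow> ('b \<Rightarrow> 'b) \<Rightarrow> 'a" where
  "trace_on B u = (\<Sum>e\<in>B. representation B (u e) e)"

lemma sum_representation:
  assumes "finite B" "independent B" "x \<in> span B"
  shows "(\<Sum>e\<in>B. representation B x e *s e) = x"
  using sum_representation_eq[OF assms(2,3,1) order_refl] .

lemma linear_coordinates:
  assumes "finite B" "independent B" "x \<in> span B" "Vector_Spaces.linear scale (*) \<phi>"
  shows "(\<Sum>e\<in>B. representation B x e * \<phi> e) = \<phi> x"
proof -
  interpret \<phi>: Vector_Spaces.linear scale "(*)" \<phi> by fact
  have "\<phi> x = \<phi> (\<Sum>e\<in>B. representation B x e *s e)"
    using sum_representation[OF assms(1-3)] by simp
  also have "\<dots> = (\<Sum>e\<in>B. representation B x e * \<phi> e)"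
    by (simp add: \<phi>.sum \<phi>.scale)
  finally show ?thesis by simp
qed

lemma representation_linear_expand:
  assumes "finite B" "independent B" "finite C" "independent C"
    and "Vector_Spaces.linear scale scale u" "u ` span B \<subseteq> span C" "x \<in> span B"
  shows "representation C (u x) e = (\<Sum>d\<in>B. representation B x d * representation C (u d) e)"
proof -
  interpret u: Vector_Spaces.linear scale scale u by fact
  have ud: "u d \<in> span C" if "d \<in> B" for d
    using assms(6) that span_base by blast
  have "u x = u (\<Sum>d\<in>B. representation B x d *s d)"
    using sum_representation[OF assms(1,2,7)] by simp
  also have "\<dots> = (\<Sum>d\<in>B. representation B x d *s u d)"
    by (simp add: u.sum u.scale)
  finally have "representation C (u x) e = (\<Sum>d\<in>B. representation C (representation B x d *s u d) e)"
    using ud by (simp add: representation_sum[OF assms(4)] span_scale)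
  also have "\<dots> = (\<Sum>d\<in>B. representation B x d * representation C (u d) e)"
    using ud by (intro sum.cong) (auto simp: representation_scale[OF assms(4)])
  finally show ?thesis .
qed

text \<open>Both sides are the same double sum of products of matrix entries. The two bases may span
  different subspaces; taking one map to be the identity gives independence of the basis.\<close>

lemma trace_on_compose_commute:
  assumes "finite B" "independent B" "finite C" "independent C"
    and u: "Vector_Spaces.linear scale scale u" "u ` span C \<subseteq> span B"
    and v: "Vector_Spaces.linear scale scale v" "v ` span B \<subseteq> span C"
  shows "trace_on B (u \<circ> v) = trace_on C (v \<circ> u)"
proof -
  have *: "representation B (u (v e)) e = (\<Sum>d\<in>C. representation C (v e) d * representation B (u d) e)"
    if "e \<in> B" for e
    using that v(2) span_base by (intro representation_linear_expand assms) blast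
  have **: "representation C (v (u d)) d = (\<Sum>e\<in>B. representation B (u d) e * representation C (v e) d)"
    if "d \<in> C" for d
    using that u(2) span_base by (intro representation_linear_expand assms) blast
  have "trace_on B (u \<circ> v) = (\<Sum>e\<in>B. \<Sum>d\<in>C. representation C (v e) d * representation B (u d) e)"
    unfolding trace_on_def by (rule sum.cong) (simp_all add: *)
  also have "\<dots> = (\<Sum>d\<in>C. \<Sum>e\<in>B. representation B (u d) e * representation C (v e) d)"
    by (subst sum.swap) (simp add: mult.commute)
  also have "\<dots> = trace_on C (v \<circ> u)"
    unfolding trace_on_def by (rule sum.cong) (simp_all add: **)
  finally show ?thesis .
qed

lemma trace_on_basis_independent:
  assumes "finite B" "independent B" "finite C" "independent C" "span B = span C"
    and "Vector_Spaces.linear scale scale u" "u ` span B \<subseteq> span B"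
  shows "trace_on B u = trace_on C u"
  using trace_on_compose_commute[OF assms(1-4), of u id] assms by (simp add: linear_id)

text \<open>The trace of \<open>u\<close> on an invariant space equals its trace on the image of that space, because
  the extra vectors of a basis adapted to the image do not contribute.\<close>

lemma trace_on_nilpotent:
  assumes "finite B" "independent B" "Vector_Spaces.linear scale scale u" "u ` span B \<subseteq> span B"
    and "\<And>x. x \<in> span B \<Longrightarrow> (u ^^ k) x = 0"
  shows "trace_on B u = 0"
  using assms
proof (induction k arbitrary: B)
  case 0
  then have "B = {}"
    using dependent_zero span_base by (metis all_not_in_conv eq_id_iff funpow_0)
  then show ?case by (simp add: trace_on_def)
next
  case (Suc k)
  interpret u: Vector_Spaces.linear scale scale u by fact
  obtain C where C: "C \<subseteq> u ` span B" "independent C" "u ` span B \<subseteq> span C"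
    by (rule basis_exists)
  have sC: "span C = u ` span B"
    using C by (metis span_minimal subspace_span u.subspace_image subset_antisym)
  have CB: "C \<subseteq> span B" using C Suc.prems(4) by auto
  have fC: "finite C" using independent_span_bound[OF Suc.prems(1) C(2) CB] by simp
  obtain D where D: "C \<subseteq> D" "D \<subseteq> span B" "independent D" "span B \<subseteq> span D"
    using maximal_independent_subset_extend[OF CB C(2)] by metis
  have fD: "finite D" using independent_span_bound[OF Suc.prems(1) D(3,2)] by simp
  have sD: "span D = span B"
    using D by (metis span_minimal subspace_span subset_antisym)
  have ud: "u d \<in> span C" if "d \<in> D" for d
    using that D(2) sC by auto
  have repr: "representation D (u d) = representation C (u d)" if "d \<in> D" for d
    using representation_extend[OF D(3) ud[OF that] D(1)] .
  have "trace_on B u = trace_on D u"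
    using Suc.prems fD D sD by (intro trace_on_basis_independent) auto
  also have "\<dots> = (\<Sum>e\<in>D. representation C (u e) e)"
    unfolding trace_on_def by (intro sum.cong) (simp_all add: repr)
  also have "\<dots> = trace_on C u"
    unfolding trace_on_def
    by (rule sum.mono_neutral_right[OF fD D(1)]) (use representation_ne_zero in blast)
  also have "\<dots> = 0"
  proof (rule Suc.IH)
    show "u ` span C \<subseteq> span C"
      using sC Suc.prems(4) by auto
    show "(u ^^ k) x = 0" if "x \<in> span C" for x
      using that Suc.prems(5) by (auto simp: sC funpow_swap1)
  qed (use fC C Suc.prems in auto)
  finally show ?case .
qed

text \<open>Turns the trace of a composite with a map of small rank into values of functionals,
  which later are entries \<open>b q (w p)\<close>.\<close>

lemma trace_on_rank_one:
  assumes "finite B" "independent B" "x \<in> span B" "Vector_Spaces.linear scale (*) \<phi>"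
  shows "trace_on B (\<lambda>z. \<phi> z *s x) = \<phi> x"
  using linear_coordinates[OF assms]
  by (simp add: trace_on_def representation_scale[OF assms(2,3)] mult.commute)

lemma trace_on_add:
  assumes "independent B" "span B = UNIV"
  shows "trace_on B (\<lambda>z. u z + v z) = trace_on B u + trace_on B v"
  using assms by (simp add: trace_on_def representation_add sum.distrib)

lemma trace_on_scale:
  assumes "independent B" "span B = UNIV"
  shows "trace_on B (\<lambda>z. c *s u z) = c * trace_on B u"
  using assms by (simp add: trace_on_def representation_scale sum_distrib_left)

text \<open>Polarisation of the trace of \<open>w \<circ> w\<close>, which vanishes for nilpotent
  \<open>w\<close>. The two cross terms agree because the trace of a product is symmetric, leaving
  twice the desired trace.\<close>

lemma trace_on_compose_nilpotent:
  assumes two: "(2::'a) \<noteq> 0" and B: "finite B" "independent B" "span B = UNIV"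
    and lin: "Vector_Spaces.linear scale scale u" "Vector_Spaces.linear scale scale v"
    and nil: "nilpotent_endo u" "nilpotent_endo v" "nilpotent_endo (\<lambda>x. u x + v x)"
  shows "trace_on B (u \<circ> v) = 0"
proof -
  have sq: "trace_on B (w \<circ> w) = 0"
    if w: "Vector_Spaces.linear scale scale w" "nilpotent_endo w" for w
  proof -
    obtain k where k: "w ^^ k = (\<lambda>x. 0)" using w(2) by (auto simp: nilpotent_endo_def)
    interpret w: Vector_Spaces.linear scale scale w by fact
    have "((w \<circ> w) ^^ m) x = (w ^^ m) ((w ^^ m) x)" for m x
    proof (induction m arbitrary: x)
      case (Suc m)
      have "((w \<circ> w) ^^ Suc m) x = ((w \<circ> w) ^^ m) (w (w x))"
        by (simp only: funpow_Suc_right o_apply)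
      also have "\<dots> = (w ^^ m) (w ((w ^^ m) (w x)))"
        by (simp only: Suc funpow_swap1)
      finally show ?case by (metis comp_apply funpow_Suc_right)
    qed simp
    then have "((w \<circ> w) ^^ k) x = 0" for x
      by (simp add: k)
    then show ?thesis
      using B w by (intro trace_on_nilpotent[of B _ k]) (auto intro: Vector_Spaces.linear_compose)
  qed
  interpret u: Vector_Spaces.linear scale scale u by fact
  interpret v: Vector_Spaces.linear scale scale v by fact
  let ?s = "\<lambda>x. u x + v x"
  have "Vector_Spaces.linear scale scale ?s"
    by (unfold linear_iff) (simp add: vector_space_axioms u.add v.add u.scale v.scale scale_right_distrib)
  then have "0 = trace_on B (?s \<circ> ?s)" using sq nil by simp
  also have "?s \<circ> ?s = (\<lambda>x. ((u \<circ> u) x + (v \<circ> v) x) + ((u \<circ> v) x + (v \<circ> u) x))"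
    by (auto simp: fun_eq_iff u.add v.add)
  also have "trace_on B \<dots> = trace_on B (u \<circ> v) + trace_on B (v \<circ> u)"
    using sq[OF lin(1) nil(1)] sq[OF lin(2) nil(2)]
    unfolding trace_on_add[OF B(2,3)] by (simp add: o_def)
  also have "trace_on B (v \<circ> u) = trace_on B (u \<circ> v)"
    using B lin by (intro trace_on_compose_commute) auto
  finally have "2 * trace_on B (u \<circ> v) = 0" by (simp only: mult_2)
  then show ?thesis using two by simp
qed

end

subsection \<open>Dimension counts by pairings\<close>

context vector_space
begin

text \<open>A basis \<open>A\<close> of \<open>W \<inter> N\<close> is extended to bases
  \<open>C\<close> of \<open>W\<close> and \<open>D\<close> of \<open>N\<close>. As \<open>A\<close>
  lies in \<open>W\<close>, it pairs to zero with \<open>W\<close>. Hence a vector of the span of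
  \<open>C - A\<close> that pairs to zero with \<open>D - A\<close> is orthogonal to
  \<open>N\<close>, so it lies in \<open>W \<inter> N\<close> and is zero; this gives at most
  \<open>card (D - A)\<close> vectors in \<open>C - A\<close>. The pairing will be the trace of a
  composite of functions: it is linear in the left factor for any right factor, but in the right
  factor only if the left one is linear. This explains the different shapes of \<open>lin1\<close>
  and \<open>lin2\<close>.\<close>

lemma dim_le_of_isotropic_pairing:
  assumes W: "subspace W" and N: "subspace N" "N \<subseteq> span S" "finite S"
    and lin1: "\<And>v. Vector_Spaces.linear scale (*) (\<lambda>w. T w v)"
    and lin2: "\<And>w. w \<in> W \<Longrightarrow> subspace {v \<in> N. T w v = 0}"
    and iso: "\<And>w w'. w \<in> W \<Longrightarrow> w' \<in> W \<Longrightarrow> T w w' = 0"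
    and orth: "\<And>w. w \<in> W \<Longrightarrow> (\<And>v. v \<in> N \<Longrightarrow> T w v = 0) \<Longrightarrow> w \<in> N"
  shows "dim W \<le> dim N"
proof -
  obtain A where A: "A \<subseteq> W \<inter> N" "independent A" "W \<inter> N \<subseteq> span A"
    by (rule basis_exists)
  obtain C where C: "A \<subseteq> C" "C \<subseteq> W" "independent C" "W \<subseteq> span C"
    using maximal_independent_subset_extend[of A W] A by auto
  obtain D where D: "A \<subseteq> D" "D \<subseteq> N" "independent D" "N \<subseteq> span D"
    using maximal_independent_subset_extend[of A N] A by auto
  have fD: "finite D"
    using independent_span_bound[of S D] D N by auto
  have fA: "finite A" using fD D finite_subset by blast
  \<comment> \<open>\<open>\<Phi>\<close> stores the pairings with \<open>D - A\<close> as
    coordinates; its injectivity on the span of \<open>C - A\<close> also yields that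
    \<open>C - A\<close> is finite.\<close>
  define \<Phi> where "\<Phi> w = (\<Sum>d\<in>D - A. T w d *s d)" for w
  interpret \<Phi>: Vector_Spaces.linear scale scale \<Phi>
  proof (unfold linear_iff, intro conjI allI)
    fix x y c
    show "\<Phi> (x + y) = \<Phi> x + \<Phi> y" "\<Phi> (c *s x) = c *s \<Phi> x"
      using lin1 by (simp_all add: \<Phi>_def linear_iff scale_left_distrib sum.distrib scale_sum_right)
  qed unfold_locales
  have sA: "span A \<subseteq> W \<inter> N"
    using A W N by (simp add: span_minimal subspace_inter)
  have sC: "span (C - A) \<subseteq> W" using C W by (meson Diff_subset span_minimal subset_trans)
  \<comment> \<open>The coordinates over \<open>C\<close> of such a vector are supported both in
    \<open>C - A\<close> and in \<open>A\<close>.\<close>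
  have disj: "w = 0" if "w \<in> span (C - A)" "w \<in> span A" for w
  proof -
    have "representation C w = representation (C - A) w" "representation C w = representation A w"
      using representation_extend[OF C(3) that(1)] representation_extend[OF C(3) that(2)] C by auto
    then have "representation C w = (\<lambda>_. 0)"
      by (metis DiffD2 ext representation_ne_zero)
    then show ?thesis
      using sum_nonzero_representation_eq[OF C(3), of w] that C sC by auto
  qed
  have ker: "w = 0" if w: "w \<in> span (C - A)" "\<Phi> w = 0" for w
  proof -
    have wW: "w \<in> W" using w sC by auto
    have D0: "T w d = 0" if "d \<in> D" for d
    proof (cases "d \<in> A")
      case True
      then show ?thesis using A iso wW by auto
    next
      case False
      then show ?thesis
        using w(2) independentD[OF D(3), of "D - A" "T w" d] fD that by (auto simp: \<Phi>_def)
    qed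
    have "span D \<subseteq> {v \<in> N. T w v = 0}"
      by (rule span_minimal[OF _ lin2[OF wW]]) (use D0 D in auto)
    then have "w \<in> N"
      using orth[OF wW] D by auto
    then show ?thesis using disj w A wW by auto
  qed
  have inj: "inj_on \<Phi> (span (C - A))"
    using ker by (subst \<Phi>.inj_on_iff_eq_0) auto
  have "independent (\<Phi> ` (C - A))"
    using inj by (intro \<Phi>.independent_injective_image independent_mono[OF C(3)]) auto
  moreover have "\<Phi> ` (C - A) \<subseteq> span (D - A)"
    by (auto simp: \<Phi>_def intro!: span_sum span_scale intro: span_base)
  ultimately have "finite (\<Phi> ` (C - A)) \<and> card (\<Phi> ` (C - A)) \<le> card (D - A)"
    using fD by (intro independent_span_bound) auto
  moreover have "inj_on \<Phi> (C - A)" using inj by (rule inj_on_subset) (rule span_superset)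
  ultimately have *: "finite (C - A)" "card (C - A) \<le> card (D - A)"
    by (auto simp: card_image finite_image_iff)
  have "dim W = card C" "dim N = card D"
    using basis_card_eq_dim C D by metis+
  moreover have "card C = card A + card (C - A)"
    using fA * C(1) by (metis card_Diff_subset card_mono finite_Diff2 le_add_diff_inverse)
  moreover have "card D = card A + card (D - A)"
    using fA fD D(1) by (simp add: card_Diff_subset card_mono)
  ultimately show ?thesis using * by simp
qed

text \<open>The families \<open>E\<close> and \<open>\<psi>\<close> are biorthogonal up to nonzero
  factors, which makes \<open>E\<close> independent, and \<open>\<psi>\<close> separates the points
  of \<open>N\<close>, which makes \<open>E\<close> spanning. The factors are not normalised to 1
  because a diagonal pair will give 2.\<close>

lemma dim_eq_card_of_coordinates:
  assumes "finite I" "subspace N" "\<And>i. i \<in> I \<Longrightarrow> E i \<in> N"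
    and lin: "\<And>i. i \<in> I \<Longrightarrow> Vector_Spaces.linear scale (*) (\<psi> i)"
    and diag: "\<And>i. i \<in> I \<Longrightarrow> \<psi> i (E i) \<noteq> 0"
    and offdiag: "\<And>i j. i \<in> I \<Longrightarrow> j \<in> I \<Longrightarrow> i \<noteq> j \<Longrightarrow> \<psi> i (E j) = 0"
    and inj: "\<And>u. u \<in> N \<Longrightarrow> (\<And>i. i \<in> I \<Longrightarrow> \<psi> i u = 0) \<Longrightarrow> u = 0"
  shows "dim N = card I \<and> N \<subseteq> span (E ` I)"
proof -
  have \<psi>_sum: "\<psi> i (\<Sum>j\<in>I. c j *s E j) = c i * \<psi> i (E i)" if "i \<in> I" for i c
  proof -
    interpret \<psi>: Vector_Spaces.linear scale "(*)" "\<psi> i" using lin that .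
    have "\<psi> i (\<Sum>j\<in>I. c j *s E j) = (\<Sum>j\<in>I. if j = i then c i * \<psi> i (E i) else 0)"
      unfolding \<psi>.sum \<psi>.scale by (rule sum.cong) (use that offdiag in auto)
    then show ?thesis using that assms(1) by simp
  qed
  have injE: "inj_on E I"
    using diag offdiag by (metis inj_onI)
  have span: "N \<subseteq> span (E ` I)"
  proof
    fix u assume u: "u \<in> N"
    \<comment> \<open>The combination of the \<open>E j\<close> with the same values under every
      \<open>\<psi> i\<close> as \<open>u\<close>.\<close>
    define v where "v = (\<Sum>j\<in>I. (\<psi> j u / \<psi> j (E j)) *s E j)"
    have "v \<in> N" unfolding v_def
      using assms(2,3) by (intro subspace_sum subspace_scale) auto
    moreover have "\<psi> i (u - v) = 0" if "i \<in> I" for i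
    proof -
      interpret \<psi>: Vector_Spaces.linear scale "(*)" "\<psi> i" using lin that .
      show ?thesis using \<psi>_sum[OF that] diag[OF that] by (simp add: \<psi>.diff v_def)
    qed
    ultimately have "u - v = 0"
      using u assms(2) by (intro inj) (auto intro: subspace_diff)
    moreover have "v \<in> span (E ` I)"
      unfolding v_def by (intro span_sum span_scale span_base imageI)
    ultimately show "u \<in> span (E ` I)" by simp
  qed
  have "independent (E ` I)"
  proof (rule independent_if_scalars_zero)
    show "finite (E ` I)" using assms(1) by simp
    fix f x assume "(\<Sum>x\<in>E ` I. f x *s x) = 0" "x \<in> E ` I"
    then obtain i where i: "i \<in> I" "x = E i" and "(\<Sum>j\<in>I. f (E j) *s E j) = 0"
      by (auto simp: sum.reindex[OF injE])
    then have "\<psi> i 0 = f (E i) * \<psi> i (E i)"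
      using \<psi>_sum[of i "\<lambda>j. f (E j)"] by simp
    moreover have "\<psi> i 0 = 0"
      using linear_iff_module_hom module_hom.zero lin i by metis
    ultimately show "f x = 0" using diag i by simp
  qed
  then have "dim N = card I"
    using span assms(3) card_image[OF injE] by (intro dim_unique[of "E ` I"]) auto
  then show ?thesis using span by simp
qed

lemma vector_space_end_scale: "vector_space (end_scale scale)"
  by unfold_locales (auto simp: end_scale_def fun_eq_iff scale_right_distrib scale_left_distrib)

end

subsection \<open>Graded bases of a reflexive form\<close>

text \<open>The scalar \<open>\<epsilon>\<close> is 1 for a symmetric and -1 for an alternating
  form, so that both cases run through the same argument.\<close>

locale reflexive_form = finite_dimensional_vector_space scale Basis
  for scale :: "'f::field \<Rightarrow> 'v::ab_group_add \<Rightarrow> 'v" (infixr "*s" 75) and Basis :: "'v set" +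
  fixes b :: "'v \<Rightarrow> 'v \<Rightarrow> 'f" and \<epsilon> :: 'f
  assumes bilinear: "bilinear_form scale b"
    and nondeg: "nondegenerate b"
    and reflect: "b y x = \<epsilon> * b x y"
    and two_neq_zero: "(2::'f) \<noteq> 0"
begin

lemma linear_right: "Vector_Spaces.linear scale (*) (b x)"
  using bilinear by (simp add: bilinear_form_def)

lemma linear_left: "Vector_Spaces.linear scale (*) (\<lambda>x. b x y)"
  using bilinear by (simp add: bilinear_form_def)

lemmas right_hom = module_hom_linearI[OF linear_right]
lemmas right_add = module_hom.add[OF right_hom]
lemmas right_scale = module_hom.scale[OF right_hom]
lemmas right_diff = module_hom.diff[OF right_hom]
lemmas right_sum = module_hom.sum[OF right_hom]
lemmas right_zero = module_hom.zero[OF right_hom]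
lemmas right_eq_0_on_span = module_hom.eq_0_on_span[OF right_hom]

lemmas left_hom = module_hom_linearI[OF linear_left]
lemmas left_add = module_hom.add[OF left_hom]
lemmas left_scale = module_hom.scale[OF left_hom]
lemmas left_sum = module_hom.sum[OF left_hom]
lemmas left_eq_0_on_span = module_hom.eq_0_on_span[OF left_hom]

lemma vector_space_field: "vector_space ((*) :: 'f \<Rightarrow> 'f \<Rightarrow> 'f)"
  using linear_right unfolding linear_iff by blast

lemma swap_eq_0_iff: "b y x = 0 \<longleftrightarrow> b x y = 0"
  using reflect by (metis mult_zero_right)

lemma eq_0_if_orthogonal:
  assumes "\<And>y. y \<in> S \<Longrightarrow> b y x = 0" "span S = UNIV"
  shows "x = 0"
proof -
  have "b y x = 0" for y
    using left_eq_0_on_span[of S x y] assms by auto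
  then show ?thesis
    using nondeg unfolding nondegenerate_def by blast
qed

lemma orthogonal_span:
  assumes "\<And>p q. p \<in> S \<Longrightarrow> q \<in> T \<Longrightarrow> b p q = 0" "x \<in> span S" "y \<in> span T"
  shows "b x y = 0"
proof -
  have "b p y = 0" if "p \<in> S" for p
    using right_eq_0_on_span[of T p y] assms that by auto
  then show ?thesis
    using left_eq_0_on_span[of S y x] assms by auto
qed

text \<open>By non-degeneracy the map \<open>\<phi>\<close>, which lists the values
  \<open>b e x\<close> as coordinates, is injective, hence surjective by finite dimension. The dual
  vectors are preimages of the basis vectors.\<close>

lemma dual_basis_exists:
  assumes "independent B" "span B = UNIV"
  obtains d where "\<And>p q. p \<in> B \<Longrightarrow> q \<in> B \<Longrightarrow> b q (d p) = (if p = q then 1 else 0)"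
proof -
  have fB: "finite B" using assms(1) by (rule finiteI_independent)
  define \<phi> where "\<phi> x = (\<Sum>e\<in>B. b e x *s e)" for x
  interpret \<phi>: Vector_Spaces.linear scale scale \<phi>
    by (unfold linear_iff)
      (simp add: vector_space_axioms \<phi>_def right_add right_scale scale_left_distrib sum.distrib scale_sum_right)
  have coeff: "c q = c' q" if "(\<Sum>e\<in>B. c e *s e) = (\<Sum>e\<in>B. c' e *s e)" "q \<in> B" for c c' q
    using independentD[OF assms(1) fB order_refl, of "\<lambda>e. c e - c' e" q] that
    by (simp add: scale_left_diff_distrib sum_subtractf)
  have "inj \<phi>"
  proof (subst \<phi>.inj_iff_eq_0, intro allI impI)
    fix x assume "\<phi> x = 0"
    then have "b e x = 0" if "e \<in> B" for e
      using coeff[of "\<lambda>e. b e x" "\<lambda>_. 0" e] that by (simp add: \<phi>_def)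
    then show "x = 0" using eq_0_if_orthogonal[of B x] assms by blast
  qed
  then have "surj \<phi>"
    by (intro linear_inj_imp_surj) unfold_locales
  then have d: "\<phi> (inv \<phi> p) = p" for p by (simp add: surj_f_inv_f)
  have "b q (inv \<phi> p) = (if p = q then 1 else 0)" if "p \<in> B" "q \<in> B" for p q
  proof -
    have "(\<Sum>e\<in>B. b e (inv \<phi> p) *s e) = p" using d[of p] by (simp add: \<phi>_def)
    also have "\<dots> = (\<Sum>e\<in>B. (if p = e then 1 else 0) *s e)"
      using that fB by (simp add: if_distrib[of "\<lambda>c. c *s _"] cong: if_cong)
    finally show ?thesis by (rule coeff) fact
  qed
  then show thesis by (rule that)
qed

text \<open>A totally singular \<open>F\<close> of greatest dimension also satisfies the last
  clause: a singular vector orthogonal to \<open>F\<close> but outside it would enlarge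
  \<open>F\<close>. The clause says that the orthogonal of \<open>F\<close> is anisotropic modulo
  \<open>F\<close>.\<close>

lemma witt_index_attained:
  obtains F where "subspace F" "\<forall>x\<in>F. \<forall>y\<in>F. b x y = 0"
    "dim F = witt_index scale b"
    "\<forall>x. (\<forall>y\<in>F. b y x = 0) \<longrightarrow> b x x = 0 \<longrightarrow> x \<in> F"
proof -
  define \<D> where "\<D> = {dim X | X. totally_singular scale b X}"
  have fin: "finite \<D>"
    by (rule finite_subset[of _ "{..dimension}"]) (auto simp: \<D>_def dim_subset_UNIV)
  have "totally_singular scale b {0}"
    by (simp add: totally_singular_def right_zero)
  then have "\<D> \<noteq> {}" by (auto simp: \<D>_def)
  then have "Max \<D> \<in> \<D>" using fin by (rule Max_in[rotated])
  then obtain F where F: "totally_singular scale b F" "dim F = Max \<D>"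
    by (auto simp: \<D>_def)
  have sF: "subspace F" using F by (simp add: totally_singular_def)
  show thesis
  proof (rule that)
    show "subspace F" by fact
    show F0: "\<forall>x\<in>F. \<forall>y\<in>F. b x y = 0"
      using F by (auto simp: totally_singular_def)
    show "dim F = witt_index scale b"
      using F by (simp add: witt_index_def \<D>_def)
    show "\<forall>x. (\<forall>y\<in>F. b y x = 0) \<longrightarrow> b x x = 0 \<longrightarrow> x \<in> F"
    proof (intro allI impI, rule ccontr)
      fix x assume x: "\<forall>y\<in>F. b y x = 0" "b x x = 0" and "x \<notin> F"
      have "totally_singular scale b (span (insert x F))"
        unfolding totally_singular_def
      proof (intro conjI ballI subspace_span)
        fix y z assume "y \<in> span (insert x F)" "z \<in> span (insert x F)"
        then show "b y z = 0"
          by (rule orthogonal_span[rotated]) (use x F0 swap_eq_0_iff in auto)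
      qed
      then have "dim (span (insert x F)) \<le> Max \<D>"
        using fin unfolding \<D>_def by (intro Max_ge) blast+
      moreover have "dim (span (insert x F)) = dim F + 1"
        using \<open>x \<notin> F\<close> sF by (metis dim_insert dim_span span_eq_iff)
      ultimately show False using F by simp
    qed
  qed
qed

end

text \<open>The weights come from a flag of a maximal totally singular subspace: negative weights for a
  basis of it, weight 0 for a complement in its orthogonal, positive weights for dual vectors. The
  assumption \<open>in_filtration\<close> says that orthogonality exchanges the steps of the filtration.\<close>

locale graded_basis = reflexive_form scale Basis b \<epsilon>
  for scale :: "'f::field \<Rightarrow> 'v::ab_group_add \<Rightarrow> 'v" (infixr "*s" 75) and Basis b \<epsilon> +
  fixes B :: "'v set" and wt :: "'v \<Rightarrow> int" and \<nu> :: nat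
  assumes independent_B: "independent B"
    and span_B: "span B = UNIV"
    and wt_bij: "bij_betw wt {p \<in> B. wt p \<noteq> 0} ({- int \<nu>..int \<nu>} - {0})"
    and b_eq_0: "p \<in> B \<Longrightarrow> q \<in> B \<Longrightarrow> wt p + wt q < 0 \<Longrightarrow> b p q = 0"
    and in_filtration:
      "(\<And>p. p \<in> B \<Longrightarrow> wt p < - k \<Longrightarrow> b p x = 0) \<Longrightarrow> x \<in> span {p \<in> B. wt p \<le> k}"
    and anisotropic:
      "x \<in> span {p \<in> B. wt p \<le> 0} \<Longrightarrow> b x x = 0 \<Longrightarrow> x \<in> span {p \<in> B. wt p \<le> -1}"

section \<open>Existence of a graded basis\<close>

context reflexive_form
begin

text \<open>\<open>C\<close> is a basis of a maximal totally singular \<open>F\<close>,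
  \<open>D\<close> extends it to a basis of the orthogonal \<open>P\<close> of \<open>F\<close>, and
  the vectors \<open>d f\<close> are dual to \<open>C\<close>. No relation is imposed on the vectors
  \<open>d f\<close> among themselves.\<close>

lemma graded_basis_exists:
  obtains B wt where "graded_basis scale Basis b \<epsilon> B wt (witt_index scale b)"
proof -
  let ?\<nu> = "witt_index scale b"
  obtain F where F: "subspace F" "\<forall>x\<in>F. \<forall>y\<in>F. b x y = 0" "dim F = ?\<nu>"
    "\<forall>x. (\<forall>y\<in>F. b y x = 0) \<longrightarrow> b x x = 0 \<longrightarrow> x \<in> F"
    by (rule witt_index_attained)
  obtain C where C: "finite C" "C \<subseteq> F" "independent C" "span C = F" "card C = ?\<nu>"
    using basis_subspace_exists[OF F(1)] F(3) by metis
  define P where "P = {x. \<forall>y\<in>F. b y x = 0}"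
  have P_iff: "x \<in> P \<longleftrightarrow> (\<forall>f\<in>C. b f x = 0)" for x
    unfolding P_def using C left_eq_0_on_span[of C x] by auto
  have "C \<subseteq> P" using C F by (auto simp: P_def)
  then obtain D where D: "C \<subseteq> D" "D \<subseteq> P" "independent D" "P \<subseteq> span D"
    using maximal_independent_subset_extend[OF _ C(3)] by metis
  have fD: "finite D" using D by (simp add: finiteI_independent)
  \<comment> \<open>\<open>C\<close> is completed to a basis of the whole space only in order to
    obtain dual vectors for its members.\<close>
  obtain X where X: "C \<subseteq> X" "independent X" "span X = UNIV"
    using maximal_independent_subset_extend[OF subset_UNIV C(3)] by (metis top.extremum_uniqueI)
  obtain d where d: "\<And>p q. p \<in> X \<Longrightarrow> q \<in> X \<Longrightarrow> b q (d p) = (if p = q then 1 else 0)"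
    using dual_basis_exists[OF X(2,3)] by metis
  have dC: "b q (d p) = (if p = q then 1 else 0)" if "p \<in> C" "q \<in> C" for p q
    by (rule d) (use X(1) that in auto)
  have injd: "inj_on d C"
    by (rule inj_onI) (metis dC zero_neq_one)
  have dnD: "d p \<notin> D" if "p \<in> C" for p
    using dC[OF that that] D that P_iff by auto
  define B where "B = D \<union> d ` C"
  \<comment> \<open>An arbitrary numbering of \<open>C\<close>, which amounts to choosing a full
    flag of \<open>F\<close>.\<close>
  obtain r0 where r0: "bij_betw r0 C {1..?\<nu>}"
    using finite_same_card_bij[OF C(1) finite_atLeastAtMost, of 1 ?\<nu>] C(5) by auto
  define r where "r p = int (r0 p)" for p
  have r: "1 \<le> r p" "r p \<le> int ?\<nu>" if "p \<in> C" for p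
    using r0 that by (auto simp: r_def bij_betw_def)
  \<comment> \<open>The order of the tests matters, since \<open>C\<close> is contained in
    \<open>D\<close>.\<close>
  define wt where "wt e = (if e \<in> C then - r e else if e \<in> D then 0 else r (inv_into C d e))" for e
  have wtC: "wt p = - r p" if "p \<in> C" for p using that by (simp add: wt_def)
  have wtD: "wt p = 0" if "p \<in> D" "p \<notin> C" for p using that by (simp add: wt_def)
  have wtd: "wt (d p) = r p" if "p \<in> C" for p
    using that dnD[OF that] D injd by (auto simp: wt_def)
  have wtD_le: "wt p \<le> 0" if "p \<in> D" for p
    using wtC wtD that r[of p] by (cases "p \<in> C") auto
  have le0: "{p \<in> B. wt p \<le> 0} = D"
    using wtD_le wtd r by (force simp: B_def)
  have lem1: "{p \<in> B. wt p \<le> -1} = C"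
    using wtd r wtC wtD D by (force simp: B_def)
  \<comment> \<open>Subtracting the dual vectors with coefficients \<open>b f x\<close> makes
    \<open>x\<close> orthogonal to \<open>F\<close>.\<close>
  have decomp: "x - (\<Sum>f\<in>C. b f x *s d f) \<in> span D" for x
  proof -
    have "b f (\<Sum>f\<in>C. b f x *s d f) = b f x" if "f \<in> C" for f
    proof -
      have "b f (\<Sum>f\<in>C. b f x *s d f) = (\<Sum>g\<in>C. if g = f then b f x else 0)"
        unfolding right_sum right_scale by (rule sum.cong) (use dC that in auto)
      then show ?thesis using C that by simp
    qed
    then show ?thesis using D by (auto simp: P_iff right_diff)
  qed
  have "graded_basis scale Basis b \<epsilon> B wt ?\<nu>"
  proof unfold_locales
    show "independent B"
    proof (rule independent_if_scalars_zero)
      show "finite B" using fD C by (simp add: B_def)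
      fix c x assume c: "(\<Sum>e\<in>B. c e *s e) = 0" and x: "x \<in> B"
      have split: "(\<Sum>e\<in>B. c e *s e) = (\<Sum>e\<in>D. c e *s e) + (\<Sum>f\<in>C. c (d f) *s d f)"
        unfolding B_def using fD C dnD
        by (subst sum.union_disjoint) (auto simp: sum.reindex[OF injd])
      have cd: "c (d f) = 0" if "f \<in> C" for f
      proof -
        \<comment> \<open>Pairing the relation with \<open>f\<close> kills the part over
          \<open>D\<close> and isolates the coefficient of \<open>d f\<close>.\<close>
        have "0 = b f (\<Sum>e\<in>B. c e *s e)" by (simp add: c right_zero)
        also have "\<dots> = (\<Sum>e\<in>D. c e * b f e) + (\<Sum>g\<in>C. c (d g) * b f (d g))"
          by (simp add: split right_add right_sum right_scale)
        also have "(\<Sum>e\<in>D. c e * b f e) = 0"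
          using D that by (intro sum.neutral) (auto simp: P_iff)
        also have "(\<Sum>g\<in>C. c (d g) * b f (d g)) = (\<Sum>g\<in>C. if g = f then c (d f) else 0)"
          by (rule sum.cong) (use dC that in auto)
        finally show ?thesis using C that by simp
      qed
      then have "(\<Sum>e\<in>D. c e *s e) = 0" using c split by simp
      then have "c e = 0" if "e \<in> D" for e
        using independentD[OF D(3) fD order_refl] that by blast
      then show "c x = 0" using x cd by (auto simp: B_def)
    qed
    show "span B = UNIV"
    proof (intro equalityI subset_UNIV subsetI)
      fix x
      have "x - (\<Sum>f\<in>C. b f x *s d f) \<in> span B"
        using decomp span_mono[of D B] by (auto simp: B_def)
      moreover have "(\<Sum>f\<in>C. b f x *s d f) \<in> span B"
        by (intro span_sum span_scale span_base) (auto simp: B_def)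
      ultimately show "x \<in> span B" by (metis diff_add_cancel span_add)
    qed
    have nz: "{p \<in> B. wt p \<noteq> 0} = C \<union> d ` C"
      using wtC wtD wtd D r by (force simp: B_def)
    have rC: "r ` C = {1..int ?\<nu>}"
      using r0 by (simp add: r_def bij_betw_def image_image[symmetric] image_int_atLeastAtMost)
    have "wt ` C = uminus ` r ` C" "wt ` d ` C = r ` C"
      using wtC wtd by (simp_all add: image_image cong: image_cong)
    then have img: "wt ` C = uminus ` {1..int ?\<nu>}" "wt ` d ` C = {1..int ?\<nu>}"
      unfolding rC .
    have "inj_on r C" using r0 by (auto simp: r_def bij_betw_def inj_on_def)
    then have "inj_on wt C" "inj_on wt (d ` C)"
      using wtC wtd by (auto simp: inj_on_def)
    moreover have "wt ` C \<inter> wt ` d ` C = {}"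
      unfolding img by auto
    ultimately have "inj_on wt (C \<union> d ` C)"
      by (auto simp: inj_on_Un)
    moreover have "wt ` (C \<union> d ` C) = {- int ?\<nu>..int ?\<nu>} - {0}"
      unfolding image_Un img by (force simp: image_iff intro: exI[of _ "- _"])
    ultimately show "bij_betw wt {p \<in> B. wt p \<noteq> 0} ({- int ?\<nu>..int ?\<nu>} - {0})"
      unfolding nz bij_betw_def by blast
    \<comment> \<open>The smaller weight is negative, so \<open>p\<close> belongs to
      \<open>C\<close>. The only member of \<open>B\<close> not orthogonal to \<open>p\<close> is
      \<open>d p\<close>, whose weight cancels that of \<open>p\<close>.\<close>
    have b0: "b p q = 0" if pq: "p \<in> B" "q \<in> B" "wt p + wt q < 0" "wt p \<le> wt q" for p q
    proof -
      have p: "p \<in> C" using pq lem1 by auto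
      show ?thesis
      proof (cases "q \<in> D")
        case True
        then show ?thesis using p D P_iff by auto
      next
        case False
        then obtain g where "g \<in> C" "q = d g" using pq by (auto simp: B_def)
        then show ?thesis using pq dC[of g p] p wtC wtd by auto
      qed
    qed
    show "b p q = 0" if "p \<in> B" "q \<in> B" "wt p + wt q < 0" for p q
      using that b0[of p q] b0[of q p] swap_eq_0_iff by (cases "wt p \<le> wt q") auto
    show "x \<in> span {p \<in> B. wt p \<le> -1}" if "x \<in> span {p \<in> B. wt p \<le> 0}" "b x x = 0" for x
    proof -
      have "b f x = 0" if "f \<in> C" for f
      proof (rule right_eq_0_on_span)
        show "x \<in> span D" using \<open>x \<in> span {p \<in> B. wt p \<le> 0}\<close> by (simp add: le0)
      qed (use D that P_iff in auto)
      then have "x \<in> P" by (simp add: P_iff)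
      then show ?thesis using F(4) \<open>b x x = 0\<close> C(4) by (auto simp: lem1 P_def)
    qed
    show "x \<in> span {p \<in> B. wt p \<le> k}"
      if x: "\<And>p. p \<in> B \<Longrightarrow> wt p < - k \<Longrightarrow> b p x = 0" for k x
    proof (cases "k \<ge> 0")
      \<comment> \<open>In \<open>decomp\<close> the part over \<open>D\<close> has weights at most
        0, and the coefficients of the \<open>d f\<close> with \<open>r f > k\<close> vanish by
        hypothesis.\<close>
      case True
      have "x - (\<Sum>f\<in>C. b f x *s d f) \<in> span {p \<in> B. wt p \<le> k}"
        using decomp span_mono[of D "{p \<in> B. wt p \<le> k}"] wtD_le True by (force simp: B_def)
      moreover have "b f x *s d f \<in> span {p \<in> B. wt p \<le> k}" if "f \<in> C" for f
      proof (cases "r f \<le> k")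
        case True
        then show ?thesis using that wtd
          by (intro span_scale span_base) (auto simp: B_def)
      next
        case False
        then have "b f x = 0" using that D wtC by (intro x) (auto simp: B_def)
        then show ?thesis by (simp add: span_zero)
      qed
      ultimately show ?thesis
        by (metis (no_types, lifting) diff_add_cancel span_add span_sum)
    next
      \<comment> \<open>Now all of \<open>D\<close> has weight below \<open>- k\<close>, so
        \<open>x\<close> lies in \<open>P\<close> and is orthogonal to \<open>P\<close>, hence
        singular; by maximality it lies in \<open>F\<close>. Its coordinate at \<open>f\<close> is
        read off by pairing with \<open>d f\<close>.\<close>
      case False
      have xD: "b p x = 0" if "p \<in> D" for p
        using that wtD_le[OF that] False by (intro x) (auto simp: B_def)
      then have "x \<in> P" using D P_iff by auto
      moreover have "b x x = 0"
        using left_eq_0_on_span[of D x x] xD \<open>x \<in> P\<close> D by auto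
      ultimately have "x \<in> span C" using F(4) C by (auto simp: P_def)
      then have xeq: "(\<Sum>f\<in>C. representation C x f *s f) = x"
        using C by (intro sum_representation) auto
      have "representation C x f *s f \<in> span {p \<in> B. wt p \<le> k}" if "f \<in> C" for f
      proof (cases "wt f \<le> k")
        case True
        then show ?thesis using that D by (intro span_scale span_base) (auto simp: B_def)
      next
        case False
        then have "b (d f) x = 0" using that wtC wtd by (intro x) (auto simp: B_def)
        then have "0 = b (\<Sum>g\<in>C. representation C x g *s g) (d f)"
          using xeq swap_eq_0_iff by simp
        also have "\<dots> = (\<Sum>g\<in>C. if g = f then representation C x f else 0)"
          unfolding left_sum left_scale by (rule sum.cong) (use dC that in auto)
        finally show ?thesis using C that by (simp add: span_zero)
      qed
      then show ?thesis by (subst xeq[symmetric]) (rule span_sum)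
    qed
  qed
  then show thesis by (rule that)
qed

end

subsection \<open>Endomorphisms lowering the filtration\<close>

context reflexive_form
begin

text \<open>The sign \<open>\<eta>\<close> is 1 for the \<open>b\<close>-symmetric and -1 for the
  \<open>b\<close>-alternating endomorphisms.\<close>

definition twisted_endos :: "'f \<Rightarrow> ('v \<Rightarrow> 'v) set" where
  "twisted_endos \<eta> = {u. Vector_Spaces.linear scale scale u \<and> (\<forall>x y. b x (u y) = \<eta> * b y (u x))}"

lemma twisted_endos_linear: "u \<in> twisted_endos \<eta> \<Longrightarrow> Vector_Spaces.linear scale scale u"
  unfolding twisted_endos_def by blast

lemma twisted_endosD: "u \<in> twisted_endos \<eta> \<Longrightarrow> b x (u y) = \<eta> * b y (u x)"
  unfolding twisted_endos_def by blast

lemma b_symmetric_endos_eq: "b_symmetric_endos scale b = twisted_endos 1"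
  by (simp add: b_symmetric_endos_def twisted_endos_def)

text \<open>One inclusion is polarisation on \<open>x + y\<close>; the other divides by 2 on the
  diagonal.\<close>

lemma b_alternating_endos_eq: "b_alternating_endos scale b = twisted_endos (-1)"
proof (intro equalityI subsetI)
  fix u assume "u \<in> b_alternating_endos scale b"
  then have lin: "Vector_Spaces.linear scale scale u" and u: "\<And>x. b x (u x) = 0"
    by (auto simp: b_alternating_endos_def)
  interpret u: Vector_Spaces.linear scale scale u by fact
  have "b x (u y) = - b y (u x)" for x y
    using u[of "x + y"] u[of x] u[of y]
    by (simp add: u.add left_add right_add eq_neg_iff_add_eq_0 add.commute)
  then show "u \<in> twisted_endos (-1)"
    unfolding twisted_endos_def mult_minus1 using lin by blast
next
  fix u assume u: "u \<in> twisted_endos (-1)"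
  have "b x (u x) = 0" for x
  proof -
    have "b x (u x) = - b x (u x)" using twisted_endosD[OF u, of x x] by simp
    then have "2 * b x (u x) = 0" by (metis add.right_inverse mult_2)
    then show ?thesis using two_neq_zero by simp
  qed
  then show "u \<in> b_alternating_endos scale b"
    using twisted_endos_linear[OF u] by (simp add: b_alternating_endos_def)
qed

text \<open>\<open>u\<close> is its own adjoint up to the scalar \<open>\<epsilon> * \<eta>\<close>,
  and each factor moved across the form contributes one such scalar.\<close>

lemma twisted_iterate:
  assumes "u \<in> twisted_endos \<eta>"
  shows "b ((u ^^ m) x) y = (\<epsilon> * \<eta>) ^ m * b x ((u ^^ m) y)"
proof (induction m arbitrary: x y)
  case (Suc m)
  have step: "b (u z) y = (\<epsilon> * \<eta>) * b z (u y)" for y z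
    using twisted_endosD[OF assms, of y z] reflect[of "u z" y] by (simp only: mult.assoc)
  have "b ((u ^^ Suc m) x) y = (\<epsilon> * \<eta>) * b ((u ^^ m) x) (u y)"
    by (simp only: funpow.simps o_apply step)
  also have "\<dots> = (\<epsilon> * \<eta>) ^ Suc m * b x ((u ^^ m) (u y))"
    by (simp only: Suc power_Suc mult.assoc)
  finally show ?case by (simp only: funpow_Suc_right o_apply)
qed simp

interpretation endo: vector_space "end_scale scale"
  by (rule vector_space_end_scale)

lemma subspace_twisted_endos: "endo.subspace (twisted_endos \<eta>)"
proof (rule endo.subspaceI)
  have [simp]: "vector_space (*s)" by (rule vector_space_axioms)
  show "0 \<in> twisted_endos \<eta>"
    by (simp add: twisted_endos_def linear_iff right_zero)
  fix u assume u: "u \<in> twisted_endos \<eta>"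
  interpret u: Vector_Spaces.linear scale scale u by (rule twisted_endos_linear[OF u])
  have "b x (c *s u y) = \<eta> * b y (c *s u x)" for c x y
    using twisted_endosD[OF u, of x y] by (simp only: right_scale mult.left_commute)
  moreover have "Vector_Spaces.linear scale scale (\<lambda>x. c *s u x)" for c
    unfolding linear_iff by (simp add: u.add u.scale scale_right_distrib mult.commute)
  ultimately show "end_scale scale c u \<in> twisted_endos \<eta>" for c
    unfolding twisted_endos_def end_scale_def by blast
  fix v assume v: "v \<in> twisted_endos \<eta>"
  interpret v: Vector_Spaces.linear scale scale v by (rule twisted_endos_linear[OF v])
  have "b x (u y + v y) = \<eta> * b y (u x + v x)" for x y
    using twisted_endosD[OF u, of x y] twisted_endosD[OF v, of x y]
    by (simp only: right_add distrib_left)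
  moreover have "Vector_Spaces.linear scale scale (\<lambda>x. u x + v x)"
    unfolding linear_iff by (simp add: u.add v.add u.scale v.scale scale_right_distrib)
  ultimately show "u + v \<in> twisted_endos \<eta>"
    unfolding twisted_endos_def plus_fun_def by blast
qed

end

section \<open>The weight filtration and the maps lowering it\<close>

context graded_basis
begin

text \<open>An increasing filtration in which the orthogonal of \<open>L k\<close> is
  \<open>L (- k - 1)\<close>, by \<open>b_eq_0\<close> and \<open>in_filtration\<close>.\<close>

abbreviation L :: "int \<Rightarrow> 'v set" where
  "L k \<equiv> span {p \<in> B. wt p \<le> k}"

text \<open>By this duality the condition on the entries \<open>b p (u q)\<close> says that
  \<open>u\<close> maps each \<open>L k\<close> into \<open>L (k - 1)\<close>. Entries are preferred
  because they serve as coordinates and show the symmetry under exchange of \<open>p\<close> and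
  \<open>q\<close>.\<close>

definition strictly_lowering :: "'f \<Rightarrow> ('v \<Rightarrow> 'v) set" where
  "strictly_lowering \<eta> =
     {u \<in> twisted_endos \<eta>. \<forall>p\<in>B. \<forall>q\<in>B. wt p + wt q \<le> 0 \<longrightarrow> b p (u q) = 0}"

lemma finite_B: "finite B"
  using independent_B by (rule finiteI_independent)

lemma wt_bounds:
  assumes "p \<in> B" shows "- int \<nu> \<le> wt p" "wt p \<le> int \<nu>"
proof -
  have "wt p \<in> {- int \<nu>..int \<nu>}"
  proof (cases "wt p = 0")
    case False
    then have "wt p \<in> wt ` {p \<in> B. wt p \<noteq> 0}" using assms by blast
    then show ?thesis unfolding bij_betw_imp_surj_on[OF wt_bij] by blast
  qed simp
  then show "- int \<nu> \<le> wt p" "wt p \<le> int \<nu>" by auto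
qed

lemma wt_inj: "p \<in> B \<Longrightarrow> q \<in> B \<Longrightarrow> wt p = wt q \<Longrightarrow> wt p \<noteq> 0 \<Longrightarrow> p = q"
  using wt_bij by (auto simp: bij_betw_def inj_on_def)

lemma card_wt:
  assumes "0 \<notin> {i..j}" "- int \<nu> \<le> i" "j \<le> int \<nu>"
  shows "card {p \<in> B. wt p \<in> {i..j}} = nat (j - i + 1)"
proof -
  have "inj_on wt {p \<in> B. wt p \<in> {i..j}}"
    using wt_inj assms(1) by (auto simp: inj_on_def)
  moreover have "wt ` {p \<in> B. wt p \<in> {i..j}} = {i..j}"
  proof (intro equalityI subsetI)
    fix k assume "k \<in> {i..j}"
    then have "k \<in> wt ` {p \<in> B. wt p \<noteq> 0}"
      using assms wt_bij by (auto simp: bij_betw_def)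
    then show "k \<in> wt ` {p \<in> B. wt p \<in> {i..j}}" using \<open>k \<in> {i..j}\<close> by auto
  qed auto
  ultimately show ?thesis
    by (metis card_image card_atLeastAtMost_int diff_add_eq add.commute)
qed

lemma L_orthogonal: "x \<in> L i \<Longrightarrow> y \<in> L j \<Longrightarrow> i + j < 0 \<Longrightarrow> b x y = 0"
  by (rule orthogonal_span[of "{p \<in> B. wt p \<le> i}" "{p \<in> B. wt p \<le> j}"]) (auto intro: b_eq_0)

lemma L_bot: "k < - int \<nu> \<Longrightarrow> L k = {0}"
proof -
  assume "k < - int \<nu>"
  then have "{p \<in> B. wt p \<le> k} = {}" using wt_bounds(1) by force
  then show ?thesis by (simp only: span_empty)
qed

lemma L_top: "L (int \<nu>) = UNIV"
proof -
  have "{p \<in> B. wt p \<le> int \<nu>} = B" using wt_bounds by auto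
  then show ?thesis using span_B by simp
qed

text \<open>For \<open>q\<close> of weight at most \<open>k\<close>, the vector \<open>u q\<close>
  is orthogonal to all \<open>p\<close> of weight at most \<open>c - k\<close>, which is what
  \<open>in_filtration\<close> asks for. The case \<open>c = 0\<close> lowers by one step,
  \<open>c = -1\<close> preserves the filtration.\<close>

lemma shift_filtration:
  assumes "Vector_Spaces.linear scale scale u"
    and "\<And>p q. p \<in> B \<Longrightarrow> q \<in> B \<Longrightarrow> wt p + wt q \<le> c \<Longrightarrow> b p (u q) = 0"
    and "x \<in> L k"
  shows "u x \<in> L (k - 1 - c)"
proof -
  interpret u: Vector_Spaces.linear scale scale u by fact
  have "u ` {p \<in> B. wt p \<le> k} \<subseteq> L (k - 1 - c)"
    by (auto intro!: in_filtration assms(2))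
  then have "span (u ` {p \<in> B. wt p \<le> k}) \<subseteq> L (k - 1 - c)"
    by (rule span_minimal) (rule subspace_span)
  then show ?thesis using assms(3) by (auto simp: u.span_image)
qed

lemma strictly_lowering_nilpotent:
  assumes "u \<in> strictly_lowering \<eta>"
  shows "nilpotent_endo u"
proof -
  have lin: "Vector_Spaces.linear scale scale u"
    using assms twisted_endos_linear by (auto simp: strictly_lowering_def)
  have "(u ^^ m) x \<in> L (int \<nu> - int m)" for m x
  proof (induction m)
    case 0
    show ?case by (simp add: L_top)
  next
    case (Suc m)
    have "u ((u ^^ m) x) \<in> L (int \<nu> - int m - 1 - 0)"
      using assms Suc by (intro shift_filtration[OF lin]) (auto simp: strictly_lowering_def)
    then show ?case by (simp add: algebra_simps)
  qed
  \<comment> \<open>There are \<open>2 * \<nu> + 1\<close> steps from \<open>L (int \<nu>)\<close>,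
    the whole space, to below the least weight.\<close>
  from this[of "2 * \<nu> + 1"] have "(u ^^ (2 * \<nu> + 1)) x = 0" for x
    using L_bot[of "int \<nu> - int (2 * \<nu> + 1)"] by auto
  then show ?thesis unfolding nilpotent_endo_def by blast
qed

text \<open>What remains are the entries with \<open>wt p + wt q = 0\<close>, that is, the action on
  the graded pieces \<open>L k / L (k - 1)\<close>. Weight 0 and the other weights are treated
  separately.\<close>

lemma strictly_lowering_if_nilpotent:
  assumes u: "u \<in> twisted_endos \<eta>" and nil: "nilpotent_endo u"
    and low: "\<And>p q. p \<in> B \<Longrightarrow> q \<in> B \<Longrightarrow> wt p + wt q < 0 \<Longrightarrow> b p (u q) = 0"
  shows "u \<in> strictly_lowering \<eta>"
proof -
  have lin: "Vector_Spaces.linear scale scale u"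
    using u by (rule twisted_endos_linear)
  interpret u: Vector_Spaces.linear scale scale u by fact
  obtain K where K: "u ^^ K = (\<lambda>x. 0)" using nil by (auto simp: nilpotent_endo_def)
  have uL: "u x \<in> L k" if "x \<in> L k" for x k
    using shift_filtration[OF lin, of "-1" x k] low that by simp
  have uLm: "(u ^^ m) x \<in> L k" if "x \<in> L k" for x k m
    by (induction m) (use that uL in auto)
  have zero: "u x \<in> L (-1)" if "x \<in> L 0" for x
  proof -
    \<comment> \<open>The exponent is lowered to 1 step by step. If the power \<open>Suc m\<close>
      sends \<open>L 0\<close> into \<open>L (-1)\<close> and \<open>m > 0\<close>, then so does
      twice \<open>m\<close>, and moving \<open>m\<close> factors across the form shows that
      \<open>(u ^^ m) x\<close> is singular; anisotropy puts it into \<open>L (-1)\<close>.\<close>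
    have "\<forall>x\<in>L 0. u x \<in> L (-1)" if "\<forall>x\<in>L 0. (u ^^ m) x \<in> L (-1)" for m
      using that
    proof (induction m)
      case 0
      then show ?case using uL by auto
    next
      case (Suc m)
      show ?case
      proof (cases m)
        case 0
        then show ?thesis using Suc.prems by simp
      next
        case (Suc l)
        have "(u ^^ m) x \<in> L (-1)" if x: "x \<in> L 0" for x
        proof (rule anisotropic)
          show "(u ^^ m) x \<in> L 0" using uLm x .
          have "(u ^^ m) ((u ^^ m) x) = (u ^^ l) ((u ^^ Suc m) x)"
            by (simp add: Suc funpow_swap1)
          also have "\<dots> \<in> L (-1)" using uLm Suc.prems x by blast
          finally have "b x ((u ^^ m) ((u ^^ m) x)) = 0"
            using L_orthogonal[OF x] by simp
          then show "b ((u ^^ m) x) ((u ^^ m) x) = 0"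
            by (simp add: twisted_iterate[OF u])
        qed
        then show ?thesis using Suc.IH by blast
      qed
    qed
    then show ?thesis using that K span_zero by (metis (no_types, lifting))
  qed
  \<comment> \<open>A nonzero weight occurs only once, so the graded piece is the line of
    \<open>q\<close> and \<open>u\<close> acts on it by a scalar \<open>\<alpha>\<close>, which is
    nilpotent and hence zero.\<close>
  have nonzero: "u q \<in> L (wt q - 1)" if q: "q \<in> B" "wt q \<noteq> 0" for q
  proof -
    let ?M = "{p \<in> B. wt p \<le> wt q - 1}"
    have "{p \<in> B. wt p \<le> wt q} = insert q ?M"
      using q wt_inj by force
    moreover have "u q \<in> L (wt q)"
      by (rule uL, rule span_base) (use q in simp)
    ultimately obtain \<alpha> where \<alpha>: "u q - \<alpha> *s q \<in> L (wt q - 1)"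
      by (auto simp: span_breakdown_eq)
    have pow: "(u ^^ m) q - \<alpha> ^ m *s q \<in> L (wt q - 1)" for m
    proof (induction m)
      case 0
      then show ?case by (simp add: span_zero)
    next
      case (Suc m)
      have "u ((u ^^ m) q - \<alpha> ^ m *s q) + \<alpha> ^ m *s (u q - \<alpha> *s q) \<in> L (wt q - 1)"
        using Suc \<alpha> by (intro span_add span_scale uL)
      then show ?case
        by (simp add: u.diff u.scale scale_right_diff_distrib mult.commute)
    qed
    have "\<alpha> = 0"
    proof (rule ccontr)
      assume "\<alpha> \<noteq> 0"
      have "\<alpha> ^ K *s q \<in> L (wt q - 1)"
        using span_neg[OF pow[of K]] K by simp
      then have "(1 / \<alpha> ^ K) *s \<alpha> ^ K *s q \<in> L (wt q - 1)" by (rule span_scale)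
      then have "q \<in> L (wt q - 1)" using \<open>\<alpha> \<noteq> 0\<close> by simp
      moreover have "?M \<subseteq> B - {q}" by auto
      ultimately have "q \<in> span (B - {q})" using span_mono by blast
      then show False using independent_B q by (auto simp: dependent_def)
    qed
    then show ?thesis using \<alpha> by simp
  qed
  have "b p (u q) = 0" if pq: "p \<in> B" "q \<in> B" "wt p + wt q \<le> 0" for p q
  proof -
    have "u q \<in> L (wt q - 1)"
    proof (cases "wt q = 0")
      case True
      then show ?thesis using zero[of q] pq by (simp add: span_base)
    qed (use nonzero pq in auto)
    moreover have "p \<in> L (wt p)" using pq by (simp add: span_base)
    ultimately show ?thesis
      using L_orthogonal[of p "wt p" "u q" "wt q - 1"] pq by linarith
  qed
  then show ?thesis using u by (auto simp: strictly_lowering_def)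
qed

section \<open>Dimension of the space of strictly lowering maps, and the upper bound\<close>

interpretation endo: vector_space "end_scale scale"
  by (rule vector_space_end_scale)

lemma subspace_strictly_lowering: "endo.subspace (strictly_lowering \<eta>)"
  using subspace_twisted_endos[of \<eta>]
  by (auto simp: strictly_lowering_def endo.subspace_def end_scale_def right_zero right_add right_scale)

text \<open>These maps of rank at most two are the test elements of the trace pairing: against
  \<open>w\<close> they give \<open>b q (w p) + \<eta> * b p (w q)\<close>.\<close>

lemma square_zero_in_strictly_lowering:
  assumes "\<eta> * \<eta> = 1" "p \<in> B" "q \<in> B" "wt p + wt q < 0"
  shows "(\<lambda>z. b q z *s p + (\<eta> * b p z) *s q) \<in> strictly_lowering \<eta>" (is "?u \<in> _")
proof -
  have "Vector_Spaces.linear scale scale ?u"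
    by (unfold linear_iff)
      (simp add: vector_space_axioms right_add right_scale algebra_simps)
  moreover have "b x (?u y) = \<eta> * b y (?u x)" for x y
  proof -
    have *: "b q y * b x p = b y q * b p x"
      using reflect[of x p] reflect[of y q] by (simp add: mult_ac)
    have **: "b p y * b x q = b y p * b q x"
      using reflect[of x q] reflect[of y p] by (simp add: mult_ac)
    have "b x (?u y) = b q y * b x p + \<eta> * (b p y * b x q)"
      by (simp add: right_add right_scale)
    also have "\<dots> = (\<eta> * \<eta>) * (b p x * b y q) + \<eta> * (b q x * b y p)"
      unfolding * ** assms(1) by (simp add: mult.commute)
    also have "\<dots> = \<eta> * b y (?u x)"
      by (simp add: right_add right_scale distrib_left)
    finally show ?thesis .
  qed
  moreover have "b p' (?u q') = 0" if "p' \<in> B" "q' \<in> B" "wt p' + wt q' \<le> 0" for p' q'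
  proof -
    \<comment> \<open>If both factors were nonzero, the four weights would have a nonnegative sum,
      but their sum is negative. The second product is handled in the same way.\<close>
    have "b q q' * b p' p = 0"
    proof (rule ccontr)
      assume "\<not> ?thesis"
      then have "\<not> wt q + wt q' < 0" "\<not> wt p' + wt p < 0"
        using b_eq_0 assms that by auto
      then show False using that assms by linarith
    qed
    moreover have "b p q' * b p' q = 0"
    proof (rule ccontr)
      assume "\<not> ?thesis"
      then have "\<not> wt p + wt q' < 0" "\<not> wt p' + wt q < 0"
        using b_eq_0 assms that by auto
      then show False using that assms by linarith
    qed
    ultimately show ?thesis by (auto simp: right_add right_scale)
  qed
  ultimately show ?thesis unfolding strictly_lowering_def twisted_endos_def by blast
qed

text \<open>Exactly one of \<open>(p, q)\<close>, \<open>(q, p)\<close> is chosen whenever \<open>wt p + wt q > 0\<close> (the diagonal only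
  if \<open>\<eta> = 1\<close>), in such a way that all fibres over \<open>p\<close> have the same size.\<close>

definition coordinate_pairs :: "'f \<Rightarrow> ('v \<times> 'v) set" where
  "coordinate_pairs \<eta> = (SIGMA p:{p \<in> B. 0 < wt p}. {q \<in> B.
     wt p < wt q \<or> (p = q \<and> \<eta> = 1) \<or> (- wt p < wt q \<and> wt q \<le> 0)})"

text \<open>The fibre over \<open>p\<close> omits from \<open>B\<close> the \<open>wt p - 1\<close>
  smaller positive weights, the \<open>\<nu> - wt p + 1\<close> weights up to \<open>- wt p\<close>,
  and \<open>p\<close> itself unless \<open>\<eta> = 1\<close>. The dependence on \<open>p\<close>
  cancels. Truncated subtraction is harmless: if \<open>\<nu> = 0\<close> there are no fibres, and
  otherwise the omitted set lies in \<open>B\<close>.\<close>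

lemma card_coordinate_pairs:
  "card (coordinate_pairs \<eta>) = \<nu> * (dim UNIV - \<nu> - (if \<eta> = 1 then 0 else 1))"
proof -
  let ?P = "{p \<in> B. 0 < wt p}"
  let ?c = "if \<eta> = 1 then 0 else 1 :: nat"
  have cardB: "card B = dim UNIV"
    using basis_card_eq_dim[of B UNIV] independent_B span_B by auto
  have P: "?P = {p \<in> B. wt p \<in> {1..int \<nu>}}" using wt_bounds by auto
  have cardP: "card ?P = \<nu>"
    unfolding P by (subst card_wt) auto
  have fibre: "card {q \<in> B. wt p < wt q \<or> (p = q \<and> \<eta> = 1) \<or> (- wt p < wt q \<and> wt q \<le> 0)}
      = dim UNIV - \<nu> - ?c" (is "card ?Q = _") if p: "p \<in> ?P" for p
  proof -
    let ?R = "{q \<in> B. wt q \<in> {1..wt p - 1}}"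
    let ?S = "{q \<in> B. wt q \<in> {- int \<nu>..- wt p}}"
    let ?T = "if \<eta> = 1 then {} else {p}"
    have eq: "q = p" if "q \<in> B" "wt q = wt p" for q using wt_inj p that by auto
    have "?Q = B - (?R \<union> ?S \<union> ?T)"
    proof (intro equalityI subsetI)
      fix q assume q: "q \<in> B - (?R \<union> ?S \<union> ?T)"
      then have "wt q < 1 \<or> wt p \<le> wt q" "- wt p < wt q"
        using wt_bounds[of q] by auto
      moreover have "q \<in> B" "wt q = wt p \<Longrightarrow> q = p" using q eq[of q] by auto
      moreover have "q = p \<Longrightarrow> \<eta> = 1" using q by (auto split: if_splits)
      ultimately show "q \<in> ?Q" by (cases "wt q = wt p") auto
    qed (use p in \<open>auto split: if_splits\<close>)
    moreover have "card (?R \<union> ?S \<union> ?T) = card ?R + card ?S + card ?T"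
      using finite_B p by (subst card_Un_disjoint; (subst card_Un_disjoint)?) auto
    moreover have "card ?R = nat (wt p - 1)"
      using p wt_bounds[of p] by (subst card_wt) auto
    moreover have "card ?S = nat (int \<nu> - wt p + 1)"
      using p wt_bounds[of p] by (subst card_wt) (auto simp: algebra_simps)
    moreover have "card ?T = ?c" by simp
    moreover have "nat (wt p - 1) + nat (int \<nu> - wt p + 1) = \<nu>"
      using p wt_bounds[of p] by auto
    ultimately show ?thesis
      using finite_B p cardB by (subst \<open>?Q = _\<close>, subst card_Diff_subset) auto
  qed
  have "card (coordinate_pairs \<eta>) = (\<Sum>p\<in>?P. dim UNIV - \<nu> - ?c)"
    unfolding coordinate_pairs_def using finite_B
    by (subst card_SigmaI) (auto intro!: sum.cong simp: fibre)
  then show ?thesis by (simp add: cardP)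
qed

text \<open>The entries \<open>b p (u q)\<close> at the chosen pairs are coordinates: the remaining
  entries follow from the symmetry under exchange of \<open>p\<close> and \<open>q\<close> or
  vanish. The maps \<open>E (p, q)\<close>, built from the dual basis, have their nonzero entries
  only at \<open>(p, q)\<close> and \<open>(q, p)\<close>.\<close>

lemma dim_strictly_lowering:
  assumes \<eta>: "\<eta> = 1 \<or> \<eta> = -1"
  shows "endo.dim (strictly_lowering \<eta>) = \<nu> * (dim UNIV - \<nu> - (if \<eta> = 1 then 0 else 1))"
    and "\<exists>S. finite S \<and> strictly_lowering \<eta> \<subseteq> endo.span S"
proof -
  obtain d where d: "\<And>p q. p \<in> B \<Longrightarrow> q \<in> B \<Longrightarrow> b q (d p) = (if p = q then 1 else 0)"
    using dual_basis_exists[OF independent_B span_B] by metis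
  let ?r = "representation B"
  have bd: "b x (d p) = ?r x p" if "p \<in> B" for x p
  proof -
    have "b x (d p) = (\<Sum>e\<in>B. ?r x e * b e (d p))"
      using linear_coordinates[OF finite_B independent_B _ linear_left] span_B by simp
    also have "\<dots> = (\<Sum>e\<in>B. if e = p then ?r x p else 0)"
      by (rule sum.cong) (use d that in auto)
    finally show ?thesis using finite_B that by simp
  qed
  define E where "E = (\<lambda>(p, q) z. ?r z q *s d p + (\<eta> * ?r z p) *s d q)"
  define \<psi> where "\<psi> = (\<lambda>(p, q) (u :: 'v \<Rightarrow> 'v). b p (u q))"
  let ?I = "coordinate_pairs \<eta>"
  have bE: "b x (E (p, q) z) = ?r z q * ?r x p + \<eta> * ?r z p * ?r x q" if "p \<in> B" "q \<in> B" for p q x z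
    using that by (simp add: E_def right_add right_scale bd)
  have IB: "p \<in> B" "q \<in> B" "0 < wt p" "0 < wt p + wt q" if "(p, q) \<in> ?I" for p q
    using that by (auto simp: coordinate_pairs_def)
  have repB: "?r q p = (if p = q then 1 else 0)" if "q \<in> B" for p q
    using representation_basis[OF independent_B that] by simp
  have \<psi>E: "\<psi> (p', q') (E (p, q)) =
      (if p' = p \<and> q' = q then 1 else 0) + (if p' = q \<and> q' = p then \<eta> else 0)"
    if "p \<in> B" "q \<in> B" "p' \<in> B" "q' \<in> B" for p q p' q'
  proof -
    have "\<psi> (p', q') (E (p, q)) = b p' (E (p, q) q')" by (simp only: \<psi>_def prod.case)
    also have "\<dots> = ?r q' q * ?r p' p + \<eta> * ?r q' p * ?r p' q" by (rule bE[OF that(1,2)])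
    also have "\<dots> = (if q = q' then 1 else 0) * (if p = p' then 1 else 0)
        + \<eta> * (if p = q' then 1 else 0) * (if q = p' then 1 else 0)"
      by (simp only: repB[OF that(3)] repB[OF that(4)])
    finally show ?thesis
      by (simp only: mult_1_left mult_1_right mult_zero_left mult_zero_right if_True if_False
          add_0_left add_0_right split: if_split) blast
  qed
  have E_in: "E i \<in> strictly_lowering \<eta>" if "i \<in> ?I" for i
  proof -
    obtain p q where i: "i = (p, q)" by (cases i)
    note pq = IB[OF that[unfolded i]]
    have "Vector_Spaces.linear scale scale (E (p, q))"
      unfolding linear_iff E_def
      by (simp add: vector_space_axioms span_B representation_add[OF independent_B]
          representation_scale[OF independent_B] algebra_simps)
    moreover have "b x (E (p, q) y) = \<eta> * b y (E (p, q) x)" for x y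
      using \<eta> pq by (auto simp: bE algebra_simps)
    moreover have "b p' (E (p, q) q') = 0" if "p' \<in> B" "q' \<in> B" "wt p' + wt q' \<le> 0" for p' q'
      using that pq by (auto simp: bE repB)
    ultimately show ?thesis
      unfolding strictly_lowering_def twisted_endos_def i by blast
  qed
  have fin: "finite ?I"
    using finite_B by (auto simp: coordinate_pairs_def)
  have "endo.dim (strictly_lowering \<eta>) = card ?I \<and> strictly_lowering \<eta> \<subseteq> endo.span (E ` ?I)"
  proof (rule endo.dim_eq_card_of_coordinates[where \<psi> = \<psi>])
    fix i assume i: "i \<in> ?I"
    obtain p q where ipq: "i = (p, q)" by (cases i)
    note pq = IB[OF i[unfolded ipq]]
    show "Vector_Spaces.linear (end_scale (*s)) (*) (\<psi> i)"
      unfolding linear_iff \<psi>_def ipq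
      by (auto simp: vector_space_field endo.vector_space_axioms end_scale_def right_add right_scale)
    \<comment> \<open>The value is 1 off the diagonal. A diagonal pair is chosen only for
      \<open>\<eta> = 1\<close> and then gives \<open>1 + \<eta> = 2\<close>.\<close>
    show "\<psi> i (E i) \<noteq> 0"
      using i \<psi>E[of p q p q] pq two_neq_zero \<eta> unfolding ipq by (auto simp: coordinate_pairs_def)
    fix j assume j: "j \<in> ?I" and ij: "i \<noteq> j"
    obtain p' q' where jpq: "j = (p', q')" by (cases j)
    note pq' = IB[OF j[unfolded jpq]]
    have n1: "\<not> (p = p' \<and> q = q')" using ij ipq jpq by blast
    \<comment> \<open>Of two pairs exchanging \<open>p\<close> and \<open>q\<close>, at most one is
      chosen off the diagonal.\<close>
    have n2: "\<not> (p = q' \<and> q = p')"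
      using i j ij unfolding ipq jpq coordinate_pairs_def by auto
    show "\<psi> i (E j) = 0"
      unfolding ipq jpq \<psi>E[OF pq'(1,2) pq(1,2)] if_not_P[OF n1] if_not_P[OF n2]
      by (rule add_0_left)
  next
    fix u assume u: "u \<in> strictly_lowering \<eta>" and z: "\<And>i. i \<in> ?I \<Longrightarrow> \<psi> i u = 0"
    have tw: "u \<in> twisted_endos \<eta>" using u by (simp add: strictly_lowering_def)
    have z': "b p (u q) = 0" if "(p, q) \<in> ?I" for p q using z[OF that] by (simp add: \<psi>_def)
    \<comment> \<open>Either the pair is chosen, or its transpose is, or \<open>p = q\<close> with
      \<open>\<eta> = -1\<close>, where the entry vanishes because \<open>u\<close> is
      alternating.\<close>
    have half: "b p (u q) = 0"
      if pq: "p \<in> B" "q \<in> B" "0 < wt p + wt q" "wt q \<le> wt p" for p q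
    proof (cases "wt q \<le> 0")
      case True
      then show ?thesis using pq by (intro z') (auto simp: coordinate_pairs_def)
    next
      case False
      show ?thesis
      proof (cases "wt q = wt p")
        case True
        then have "p = q" using pq False by (intro wt_inj) auto
        show ?thesis
        proof (cases "\<eta> = 1")
          case True
          then show ?thesis using pq False by (intro z') (auto simp: coordinate_pairs_def \<open>p = q\<close>)
        next
          case False
          then have "u \<in> b_alternating_endos scale b"
            using \<eta> tw by (simp add: b_alternating_endos_eq)
          then show ?thesis by (simp add: b_alternating_endos_def \<open>p = q\<close>)
        qed
      next
        case neq: False
        have "b q (u p) = 0"
          using pq neq False by (intro z') (auto simp: coordinate_pairs_def)
        then show ?thesis using twisted_endosD[OF tw, of p q] by simp
      qed
    qed
    have all: "b p (u q) = 0" if pq: "p \<in> B" "q \<in> B" for p q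
    proof (cases "0 < wt p + wt q")
      case True
      show ?thesis
      proof (cases "wt q \<le> wt p")
        case False
        then have "b q (u p) = 0" using half[of q p] True pq by auto
        then show ?thesis using twisted_endosD[OF tw, of p q] by simp
      qed (use half True pq in auto)
    qed (use u pq in \<open>auto simp: strictly_lowering_def\<close>)
    interpret u: Vector_Spaces.linear scale scale u by (rule twisted_endos_linear[OF tw])
    have "u q = 0" if "q \<in> B" for q
      by (rule eq_0_if_orthogonal[OF _ span_B]) (use all that in auto)
    then have "u x = 0" for x
      using u.eq_0_on_span[of B x] span_B by auto
    then show "u = 0" by (simp add: fun_eq_iff)
  qed (use fin subspace_strictly_lowering E_in in auto)
  then show "endo.dim (strictly_lowering \<eta>) = \<nu> * (dim UNIV - \<nu> - (if \<eta> = 1 then 0 else 1))"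
    and "\<exists>S. finite S \<and> strictly_lowering \<eta> \<subseteq> endo.span S"
    using fin card_coordinate_pairs[of \<eta>] by auto
qed

text \<open>The pairing is the trace of the composite: polarisation makes it vanish on
  \<open>W\<close>, and the rank two test maps show that orthogonality to the strictly lowering maps
  forces \<open>w\<close> to preserve the filtration.\<close>

lemma dim_nilpotent_le:
  assumes \<eta>: "\<eta> = 1 \<or> \<eta> = -1"
    and W: "endo.subspace W" "W \<subseteq> twisted_endos \<eta>" "\<forall>u\<in>W. nilpotent_endo u"
  shows "endo.dim W \<le> endo.dim (strictly_lowering \<eta>)"
proof -
  obtain S where S: "finite S" "strictly_lowering \<eta> \<subseteq> endo.span S"
    using dim_strictly_lowering(2)[OF \<eta>] by blast
  note add = trace_on_add[OF independent_B span_B] and scl = trace_on_scale[OF independent_B span_B]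
  show ?thesis
  proof (rule endo.dim_le_of_isotropic_pairing[OF W(1) subspace_strictly_lowering S(2,1),
        where T = "\<lambda>u v. trace_on B (u \<circ> v)"])
    show "Vector_Spaces.linear (end_scale (*s)) (*) (\<lambda>w. trace_on B (w \<circ> v))" for v
      unfolding linear_iff
      by (auto simp: vector_space_field endo.vector_space_axioms end_scale_def o_def add scl)
    fix w assume w: "w \<in> W"
    then have tw: "w \<in> twisted_endos \<eta>" using W by auto
    interpret w: Vector_Spaces.linear scale scale w by (rule twisted_endos_linear[OF tw])
    show "endo.subspace {v \<in> strictly_lowering \<eta>. trace_on B (w \<circ> v) = 0}"
      \<comment> \<open>\<open>scl[of 0]\<close> supplies the trace of the zero map.\<close>
      using subspace_strictly_lowering[of \<eta>] scl[of 0]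
      by (auto simp: endo.subspace_def o_def w.add w.scale w.zero add scl end_scale_def)
    show "trace_on B (w \<circ> w') = 0" if w': "w' \<in> W" for w'
    proof (rule trace_on_compose_nilpotent[OF two_neq_zero finite_B independent_B span_B])
      have "w + w' \<in> W" using W(1) w w' by (rule endo.subspace_add)
      then show "nilpotent_endo (\<lambda>x. w x + w' x)" using W(3) unfolding plus_fun_def by blast
    qed (use W w w' twisted_endos_linear in auto)
    assume orth: "\<And>v. v \<in> strictly_lowering \<eta> \<Longrightarrow> trace_on B (w \<circ> v) = 0"
    show "w \<in> strictly_lowering \<eta>"
    proof (rule strictly_lowering_if_nilpotent[OF tw])
      show "nilpotent_endo w" using W w by auto
      fix q p assume pq: "q \<in> B" "p \<in> B" "wt q + wt p < 0"
      have "(\<lambda>z. b q z *s p + (\<eta> * b p z) *s q) \<in> strictly_lowering \<eta>"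
        using \<eta> pq by (intro square_zero_in_strictly_lowering) auto
      from orth[OF this]
      have "0 = trace_on B (\<lambda>z. b q z *s w p + \<eta> *s b p z *s w q)"
        by (simp add: o_def w.add w.scale)
      also have "\<dots> = b q (w p) + \<eta> * b p (w q)"
        using trace_on_rank_one[OF finite_B independent_B _ linear_right] span_B
        by (simp add: add scl del: scale_scale)
      \<comment> \<open>The twisted symmetry makes both summands equal, so the trace is twice the
        entry sought.\<close>
      also have "\<eta> * b p (w q) = b q (w p)"
        using twisted_endosD[OF tw, of q p] by simp
      finally have "2 * b q (w p) = 0" by (simp only: mult_2)
      then show "b q (w p) = 0" using two_neq_zero by simp
    qed
  qed
qed

end

section \<open>The maximal dimension for both symmetry types\<close>

context reflexive_form
begin

lemma max_dim_nilpotent_twisted: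
  assumes "\<eta> = 1 \<or> \<eta> = -1"
  defines "m \<equiv> witt_index scale b * (dim UNIV - witt_index scale b - (if \<eta> = 1 then 0 else 1))"
  shows "\<exists>W. module.subspace (end_scale scale) W \<and> W \<subseteq> twisted_endos \<eta>
      \<and> (\<forall>u\<in>W. nilpotent_endo u) \<and> vector_space.dim (end_scale scale) W = m"
    and "\<forall>W. module.subspace (end_scale scale) W \<and> W \<subseteq> twisted_endos \<eta>
      \<and> (\<forall>u\<in>W. nilpotent_endo u) \<longrightarrow> vector_space.dim (end_scale scale) W \<le> m"
proof -
  obtain B wt where "graded_basis scale Basis b \<epsilon> B wt (witt_index scale b)"
    by (rule graded_basis_exists)
  then interpret graded_basis scale Basis b \<epsilon> B wt "witt_index scale b" .
  show "\<exists>W. module.subspace (end_scale scale) W \<and> W \<subseteq> twisted_endos \<eta>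
      \<and> (\<forall>u\<in>W. nilpotent_endo u) \<and> vector_space.dim (end_scale scale) W = m"
    using subspace_strictly_lowering[of \<eta>] strictly_lowering_nilpotent dim_strictly_lowering(1)[OF assms(1)]
    unfolding m_def by (intro exI[of _ "strictly_lowering \<eta>"]) (auto simp: strictly_lowering_def)
  show "\<forall>W. module.subspace (end_scale scale) W \<and> W \<subseteq> twisted_endos \<eta>
      \<and> (\<forall>u\<in>W. nilpotent_endo u) \<longrightarrow> vector_space.dim (end_scale scale) W \<le> m"
    using dim_nilpotent_le[OF assms(1)] dim_strictly_lowering(1)[OF assms(1)]
    unfolding m_def by auto
qed

end

theorem mainTheorem1:
  fixes scale :: "'f::field \<Rightarrow> 'v::ab_group_add \<Rightarrow> 'v"
    and Basis :: "'v set"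
    and b :: "'v \<Rightarrow> 'v \<Rightarrow> 'f"
  assumes fdvs: "finite_dimensional_vector_space scale Basis"
    and char: "(2::'f) \<noteq> 0"
    and bil: "bilinear_form scale b"
    and nondeg: "nondegenerate b"
    and symalt: "symmetric_form b \<or> alternating_form b"
  defines "n \<equiv> vector_space.dim scale (UNIV :: 'v set)"
    and "\<nu> \<equiv> witt_index scale b"
  shows
    "((\<exists>W. module.subspace (end_scale scale) W \<and> W \<subseteq> b_symmetric_endos scale b
          \<and> (\<forall>u\<in>W. nilpotent_endo u)
          \<and> vector_space.dim (end_scale scale) W = \<nu> * (n - \<nu>))
      \<and> (\<forall>W. module.subspace (end_scale scale) W \<and> W \<subseteq> b_symmetric_endos scale b
          \<and> (\<forall>u\<in>W. nilpotent_endo u)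
          \<longrightarrow> vector_space.dim (end_scale scale) W \<le> \<nu> * (n - \<nu>)))
     \<and>
     ((\<exists>W. module.subspace (end_scale scale) W \<and> W \<subseteq> b_alternating_endos scale b
          \<and> (\<forall>u\<in>W. nilpotent_endo u)
          \<and> vector_space.dim (end_scale scale) W = \<nu> * (n - \<nu> - 1))
      \<and> (\<forall>W. module.subspace (end_scale scale) W \<and> W \<subseteq> b_alternating_endos scale b
          \<and> (\<forall>u\<in>W. nilpotent_endo u)
          \<longrightarrow> vector_space.dim (end_scale scale) W \<le> \<nu> * (n - \<nu> - 1)))"
proof -
  interpret finite_dimensional_vector_space scale Basis by fact
  have "\<exists>\<epsilon>. \<forall>x y. b y x = \<epsilon> * b x y"
    using symalt
  proof
    assume "symmetric_form b"
    then show ?thesis by (intro exI[of _ 1]) (simp add: symmetric_form_def)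
  next
    assume alt: "alternating_form b"
    have "b y x = -1 * b x y" for x y
    proof -
      have "b (x + y) (x + y) = b x x + b x y + (b y x + b y y)"
        using bil by (simp add: bilinear_form_def linear_iff)
      then have "b y x = - b x y"
        using alt by (simp add: alternating_form_def eq_neg_iff_add_eq_0 add.commute)
      then show ?thesis by (simp only: mult_minus1)
    qed
    then show ?thesis by blast
  qed
  then obtain \<epsilon> where \<epsilon>: "\<And>x y. b y x = \<epsilon> * b x y" by blast
  interpret reflexive_form scale Basis b \<epsilon>
    by unfold_locales (fact bil nondeg \<epsilon> char)+
  \<comment> \<open>Needed so that the correction term for \<open>\<eta> = -1\<close> evaluates to 1
    and not to 0.\<close>
  have "(-1::'f) \<noteq> 1" using char by (metis add.right_inverse one_add_one)
  then show ?thesis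
    using max_dim_nilpotent_twisted[of 1] max_dim_nilpotent_twisted[of "-1"]
    unfolding b_symmetric_endos_eq b_alternating_endos_eq n_def \<nu>_def by simp
qed

end
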